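(* Let $f^0(x,y)$ be a curvature surface on $D=\{(x,y)\in\mathbb{R}^2:x>0\}$. Then: (1) Any $x$-curve $x\mapsto f^0(x,y)$ with fixed $y\neq0$ has a cusp of type $(2,3,4)$ at $x=|y|$. (2) Any $y$-curve $y\mapsto f^0(x,y)$ with fixed $x>0$ has a cusp of type $(2,3,4)$ at $y=0$.
   Context: $X_0(x)=\frac52+\sum_{k\ge1}a_kx^{2k}$ (analytic on $\mathbb{R}$), $a_1=1$, $2(k+1)(4k^2+\frac54)a_{k+1}+(2k-1)a_k=0$ $(k\ge1)$. $h(x,y)=2X_0-xX_0'+y^2\frac{X_0'}{x}+\sqrt5$ (positive). On $D$ put $a_1=\frac{2y}{xh}(X_0+\frac{\sqrt5}{2})$, $b_1=-\frac{1}{xh}(X_0+\frac{\sqrt5}{2}+\sqrt5(x^2-y^2))$, $c_1=-\frac{2}{xh}(X_0+\frac{\sqrt5}{2})$, $a_2=-\frac1h(2X_0+\sqrt5-(x^2+y^2)\frac{X_0'}{x})$, $b_2=-\frac{2y}{h}(\frac{X_0'}{2x}+\sqrt5)$, $c_2=\frac{2y}{h}(X_0''-\frac{X_0'}{x})$. A frame field is an analytic orthonormal frame field $F^0=[\phi,X^0_\alpha,X^0_\beta,\xi]$ of $\mathbb{R}^4$ on $D$ satisfying $\phi_x=-a_1X^0_\alpha$, $\xi_x=b_1X^0_\alpha$, $(X^0_\beta)_x=c_1X^0_\alpha$, $(X^0_\alpha)_x=a_1\phi-b_1\xi-c_1X^0_\beta$, $\phi_y=-a_2X^0_\beta$, $\xi_y=b_2X^0_\beta$,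 $(X^0_\alpha)_y=c_2X^0_\beta$, $(X^0_\beta)_y=a_2\phi-b_2\xi-c_2X^0_\alpha$ (it exists and is unique up to left multiplication by a constant orthogonal matrix). The curvature surface $f^0:D\to\mathbb{R}^4$ determined by $F^0$ is the analytic map, unique up to translation, with $df^0=\frac{x^2-y^2}{xh}X^0_\alpha dx+\frac{2y}{h}X^0_\beta dy$. Every $x$-curve and every $y$-curve of $f^0$ is contained in some affine hyperplane of $\mathbb{R}^4$ (a $3$-dimensional Euclidean space). A curve $p(t)$ in a Euclidean $3$-space has a cusp of type $(2,3,4)$ at $t=0$ if, after translating so that $p(0)=\boldsymbol{0}$ and in suitable orthonormal coordinates, $p(t)=(at^2+O(t^3),\,bt^3+O(t^4),\,ct^4+O(t^5))$ as $t\to0$, with constants $a,b,c$ satisfying $abc\ne0$ (for a cusp at another parameter value, shift the parameter). *)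

theory Defs
  imports "HOL-Analysis.Analysis" "HOL-Library.Landau_Symbols"
begin

text \<open>Coefficients of \<open>X\<^sub>0(x) = 5/2 + \<Sum>k\<ge>1. a\<^sub>k x\<^sup>2\<^sup>k\<close>, with the recursion solved for the
  leading term; \<open>X0_coeff_rec\<close> is its original form.\<close>

fun X0_coeff :: "nat \<Rightarrow> real" where
  "X0_coeff 0 = 5/2"
| "X0_coeff (Suc 0) = 1"
| "X0_coeff (Suc (Suc k)) =
     - ((2 * real (Suc k) - 1) * X0_coeff (Suc k))
       / (2 * (real (Suc k) + 1) * (4 * (real (Suc k))\<^sup>2 + 5/4))"

lemma X0_coeff_rec:
  assumes "k \<ge> 1"
  shows "2 * (real k + 1) * (4 * (real k)\<^sup>2 + 5/4) * X0_coeff (k + 1)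
           + (2 * real k - 1) * X0_coeff k = 0"
proof -
  obtain m where k: "k = Suc m"
    using assms by (cases k) auto
  have "4 * (1 + real m)\<^sup>2 + 5/4 > 0"
    by (intro add_nonneg_pos) auto
  then have "4 * (1 + real m)\<^sup>2 + 5/4 \<noteq> 0"
    by linarith
  then show ?thesis
    unfolding k by simp
qed

definition X0 :: "real \<Rightarrow> real" where
  "X0 x = (\<Sum>k. X0_coeff k * x ^ (2 * k))"

abbreviation X0' :: "real \<Rightarrow> real" where "X0' \<equiv> deriv X0"
abbreviation X0'' :: "real \<Rightarrow> real" where "X0'' \<equiv> deriv (deriv X0)"

definition h :: "real \<Rightarrow> real \<Rightarrow> real" where
  "h x y = 2 * X0 x - x * X0' x + y\<^sup>2 * (X0' x / x) + sqrt 5"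

definition a1 :: "real \<Rightarrow> real \<Rightarrow> real" where
  "a1 x y = 2 * y / (x * h x y) * (X0 x + sqrt 5 / 2)"

definition b1 :: "real \<Rightarrow> real \<Rightarrow> real" where
  "b1 x y = - (1 / (x * h x y)) * (X0 x + sqrt 5 / 2 + sqrt 5 * (x\<^sup>2 - y\<^sup>2))"

definition c1 :: "real \<Rightarrow> real \<Rightarrow> real" where
  "c1 x y = - (2 / (x * h x y)) * (X0 x + sqrt 5 / 2)"

definition a2 :: "real \<Rightarrow> real \<Rightarrow> real" where
  "a2 x y = - (1 / h x y) * (2 * X0 x + sqrt 5 - (x\<^sup>2 + y\<^sup>2) * (X0' x / x))"

definition b2 :: "real \<Rightarrow> real \<Rightarrow> real" where
  "b2 x y = - (2 * y / h x y) * (X0' x / (2 * x) + sqrt 5)"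

definition c2 :: "real \<Rightarrow> real \<Rightarrow> real" where
  "c2 x y = 2 * y / h x y * (X0'' x - X0' x / x)"

definition half_plane :: "(real \<times> real) set" where
  "half_plane = {(x, y). x > 0}"

text \<open>Real analyticity in two variables on an open set: near every point the map is the sum
  of an absolutely convergent double power series.\<close>

definition real_analytic2_on ::
    "(real \<times> real \<Rightarrow> 'a::euclidean_space) \<Rightarrow> (real \<times> real) set \<Rightarrow> bool" where
  "real_analytic2_on g S \<longleftrightarrow>
     (\<forall>(x0, y0) \<in> S. \<exists>r>0. \<exists>c :: nat \<Rightarrow> nat \<Rightarrow> 'a.
        \<forall>x y. \<bar>x - x0\<bar> < r \<longrightarrow> \<bar>y - y0\<bar> < r \<longrightarrow>
          ((\<lambda>(i, j). ((x - x0) ^ i * (y - y0) ^ j) *\<^sub>R c i j) has_sum g (x, y)) UNIV)"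

definition orthonormal_list :: "'a::real_inner list \<Rightarrow> bool" where
  "orthonormal_list es \<longleftrightarrow>
     (\<forall>i<length es. \<forall>j<length es. es ! i \<bullet> es ! j = (if i = j then 1 else 0))"

definition frame_field ::
    "(real \<times> real \<Rightarrow> real^4) \<Rightarrow> (real \<times> real \<Rightarrow> real^4) \<Rightarrow>
     (real \<times> real \<Rightarrow> real^4) \<Rightarrow> (real \<times> real \<Rightarrow> real^4) \<Rightarrow> bool" where
  "frame_field \<phi> X\<alpha> X\<beta> \<xi> \<longleftrightarrow>
     real_analytic2_on \<phi> half_plane \<and> real_analytic2_on X\<alpha> half_plane \<and>
     real_analytic2_on X\<beta> half_plane \<and> real_analytic2_on \<xi> half_plane \<and>
     (\<forall>(x, y) \<in> half_plane.
        orthonormal_list [\<phi> (x, y), X\<alpha> (x, y), X\<beta> (x, y), \<xi> (x, y)] \<and>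
        ((\<lambda>s. \<phi> (s, y)) has_vector_derivative - a1 x y *\<^sub>R X\<alpha> (x, y)) (at x) \<and>
        ((\<lambda>s. \<xi> (s, y)) has_vector_derivative b1 x y *\<^sub>R X\<alpha> (x, y)) (at x) \<and>
        ((\<lambda>s. X\<beta> (s, y)) has_vector_derivative c1 x y *\<^sub>R X\<alpha> (x, y)) (at x) \<and>
        ((\<lambda>s. X\<alpha> (s, y)) has_vector_derivative
            a1 x y *\<^sub>R \<phi> (x, y) - b1 x y *\<^sub>R \<xi> (x, y) - c1 x y *\<^sub>R X\<beta> (x, y)) (at x) \<and>
        ((\<lambda>t. \<phi> (x, t)) has_vector_derivative - a2 x y *\<^sub>R X\<beta> (x, y)) (at y) \<and>
        ((\<lambda>t. \<xi> (x, t)) has_vector_derivative b2 x y *\<^sub>R X\<beta> (x, y)) (at y) \<and>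
        ((\<lambda>t. X\<alpha> (x, t)) has_vector_derivative c2 x y *\<^sub>R X\<beta> (x, y)) (at y) \<and>
        ((\<lambda>t. X\<beta> (x, t)) has_vector_derivative
            a2 x y *\<^sub>R \<phi> (x, y) - b2 x y *\<^sub>R \<xi> (x, y) - c2 x y *\<^sub>R X\<alpha> (x, y)) (at y))"

definition curvature_surface :: "(real \<times> real \<Rightarrow> real^4) \<Rightarrow> bool" where
  "curvature_surface f \<longleftrightarrow>
     real_analytic2_on f half_plane \<and>
     (\<exists>\<phi> X\<alpha> X\<beta> \<xi>. frame_field \<phi> X\<alpha> X\<beta> \<xi> \<and>
        (\<forall>(x, y) \<in> half_plane.
           (f has_derivative
              (\<lambda>(dx, dy). (dx * ((x\<^sup>2 - y\<^sup>2) / (x * h x y))) *\<^sub>R X\<alpha> (x, y)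
                        + (dy * (2 * y / h x y)) *\<^sub>R X\<beta> (x, y))) (at (x, y))))"

text \<open>The curve \<open>p\<close>, defined on the parameter set \<open>I\<close>, lies in the 3-dimensional affine
  subspace \<open>V\<close> and has a cusp of type (2,3,4) at the interior parameter \<open>t0\<close>. The condition
  \<open>p t0 + e \<in> V\<close> says that the vector \<open>e\<close> is parallel to \<open>V\<close>, so that \<open>e1, e2, e3\<close> are the axes
  of orthonormal coordinates of \<open>V\<close> with origin \<open>p t0\<close>.\<close>

definition cusp_234_in ::
    "'a::euclidean_space set \<Rightarrow> real set \<Rightarrow> (real \<Rightarrow> 'a) \<Rightarrow> real \<Rightarrow> bool" where
  "cusp_234_in V I p t0 \<longleftrightarrow>
     affine V \<and> aff_dim V = 3 \<and> p ` I \<subseteq> V \<and> t0 \<in> interior I \<and>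
     (\<exists>e1 e2 e3. \<exists>a b c :: real.
        orthonormal_list [e1, e2, e3] \<and> p t0 + e1 \<in> V \<and> p t0 + e2 \<in> V \<and> p t0 + e3 \<in> V \<and>
        a * b * c \<noteq> 0 \<and>
        (\<lambda>t. (p (t0 + t) - p t0) \<bullet> e1 - a * t ^ 2) \<in> O[at 0](\<lambda>t. t ^ 3) \<and>
        (\<lambda>t. (p (t0 + t) - p t0) \<bullet> e2 - b * t ^ 3) \<in> O[at 0](\<lambda>t. t ^ 4) \<and>
        (\<lambda>t. (p (t0 + t) - p t0) \<bullet> e3 - c * t ^ 4) \<in> O[at 0](\<lambda>t. t ^ 5))"

end

theory Submission
  imports Defs
begin

text \<open>
  Along a coordinate curve the velocity is \<open>u v\<close> with \<open>v\<close> a unit frame vector and \<open>u\<close> a function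
  with a simple zero, and \<open>v' = K m + L w\<close> where \<open>m, w\<close> are orthonormal, \<open>m' = - K v\<close> and
  \<open>w' = - L v\<close>. Together with a constant normal vector this places the curve in a hyperplane, and it
  has a (2,3,4)-cusp as soon as \<open>v\<close>, \<open>v'\<close>, \<open>v''\<close> are independent at the zero of \<open>u\<close>, that is,
  when \<open>K L' - L K' \<noteq> 0\<close> there.

  The required nonvanishing rests on the first integral
  \<open>(\<theta> W)\<^sup>2 + (x\<^sup>2 + 5/4) W\<^sup>2 + 5 = 2 X\<^sub>0 W\<close> (\<open>W = X\<^sub>0' / x\<close>, \<open>\<theta> = x d/dx\<close>) of the
  differential equation encoded by the recursion for the coefficients of \<open>X\<^sub>0\<close>: it forces
  \<open>W > 0\<close> and \<open>2 X\<^sub>0 > x\<^sup>2 W\<close>.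
\<close>

section \<open>The power series of \<open>X0\<close> in the variable \<open>x^2\<close> and its
  differential equation\<close>

definition X0_fps :: "real fps" where
  "X0_fps = Abs_fps X0_coeff"

text \<open>The recursion extends to \<open>k = 0\<close>, where it reads
  \<open>5/2 * 1 - 5/2 = 0\<close> thanks to the constant term 5/2. Hence one differential equation
  captures all coefficients.\<close>

lemma X0_coeff_Suc:
  "2 * (real k + 1) * (4 * (real k)\<^sup>2 + 5/4) * X0_coeff (Suc k) + (2 * real k - 1) * X0_coeff k = 0"
  using X0_coeff_rec[of k] by (cases k) auto

text \<open>Since \<open>|2k - 1| \<le> 8k^2 + 5/2\<close>, each step of the recursion multiplies by
  a factor of absolute value at most \<open>1/(k + 1)\<close>. The factorial bound makes the series
  entire by comparison with exp.\<close>

lemma abs_X0_coeff_le: "\<bar>X0_coeff k\<bar> \<le> 5/2 / fact k"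
proof (induction k)
  case (Suc k)
  let ?d = "2 * (4 * (real k)\<^sup>2 + 5/4)"
  have d: "?d > 0"
    by (simp add: add_nonneg_pos)
  have "\<bar>2 * real k - 1\<bar> \<le> ?d"
  proof -
    have "0 \<le> (4 * real k - 1)\<^sup>2" by simp
    then show ?thesis unfolding power2_eq_square by (simp add: algebra_simps abs_le_iff)
  qed
  have "?d * ((real k + 1) * X0_coeff (Suc k)) = - ((2 * real k - 1) * X0_coeff k)"
    using X0_coeff_Suc[of k] by (simp add: algebra_simps)
  from arg_cong[OF this, of abs]
  have "?d * ((real k + 1) * \<bar>X0_coeff (Suc k)\<bar>) = \<bar>2 * real k - 1\<bar> * \<bar>X0_coeff k\<bar>"
    using abs_of_pos[OF d] by (simp only: abs_mult abs_minus_cancel)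
  also have "\<dots> \<le> ?d * \<bar>X0_coeff k\<bar>"
    using \<open>\<bar>2 * real k - 1\<bar> \<le> ?d\<close> by (intro mult_right_mono) auto
  finally have "(real k + 1) * \<bar>X0_coeff (Suc k)\<bar> \<le> \<bar>X0_coeff k\<bar>"
    using d by (metis mult_le_cancel_left_pos)
  also have "\<dots> \<le> 5/2 / fact k" by fact
  finally have "(real k + 1) * \<bar>X0_coeff (Suc k)\<bar> * fact k \<le> 5/2"
    by (simp add: pos_le_divide_eq)
  then show ?case
    by (subst pos_le_divide_eq) (simp_all add: algebra_simps add_pos_nonneg)
qed simp

lemma fps_conv_radius_X0_fps: "fps_conv_radius X0_fps = \<infinity>"
  unfolding fps_conv_radius_def
proof (rule conv_radius_inftyI'')
  fix z :: real
  have "summable (\<lambda>n. norm (5/2 * (\<bar>z\<bar> ^ n /\<^sub>R fact n)))"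
    using summable_norm_exp[of "\<bar>z\<bar>"]
    by (simp add: summable_mult norm_mult del: times_divide_eq_left)
  then show "summable (\<lambda>n. fps_nth X0_fps n * z ^ n)"
  proof (rule summable_comparison_test'[where N = 0, OF summable_norm_cancel])
    fix n
    have "\<bar>X0_coeff n\<bar> * \<bar>z\<bar> ^ n \<le> 5/2 / fact n * \<bar>z\<bar> ^ n"
      by (intro mult_right_mono abs_X0_coeff_le) auto
    then show "norm (fps_nth X0_fps n * z ^ n) \<le> 5/2 * (\<bar>z\<bar> ^ n /\<^sub>R fact n)"
      by (simp add: X0_fps_def abs_mult power_abs field_simps)
  qed
qed

text \<open>\<open>X0_series n z\<close> is the \<open>n\<close>-th derivative of \<open>\<Sum>k. a\<^sub>k z\<^sup>k\<close> in the variable \<open>z = x\<^sup>2\<close>.\<close>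

definition X0_series :: "nat \<Rightarrow> real \<Rightarrow> real" where
  "X0_series n = eval_fps ((fps_deriv ^^ n) X0_fps)"

lemma fps_conv_radius_deriv_X0_fps [simp]: "fps_conv_radius ((fps_deriv ^^ n) X0_fps) = \<infinity>"
proof (induction n)
  case 0
  then show ?case by (simp add: fps_conv_radius_X0_fps)
next
  case (Suc n)
  then show ?case
    using fps_conv_radius_deriv[of "(fps_deriv ^^ n) X0_fps"] by simp
qed

lemma X0_series_has_derivative [derivative_intros]:
  assumes "(g has_field_derivative g') (at x within S)"
  shows "((\<lambda>x. X0_series n (g x)) has_field_derivative X0_series (Suc n) (g x) * g') (at x within S)"
proof -
  have "(X0_series n has_field_derivative X0_series (Suc n) (g x)) (at (g x))"
    unfolding X0_series_def by (simp add: has_field_derivative_eval_fps)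
  from DERIV_chain2[OF this assms] show ?thesis .
qed

lemma X0_eq_series: "X0 x = X0_series 0 (x\<^sup>2)"
  by (simp add: X0_def X0_series_def eval_fps_def X0_fps_def power_mult)

lemma fps_conv_radius_eq_infinity:
  fixes f g :: "real fps"
  assumes "fps_conv_radius f = \<infinity>" "fps_conv_radius g = \<infinity>"
  shows "fps_conv_radius (f + g) = \<infinity>" "fps_conv_radius (f - g) = \<infinity>" "fps_conv_radius (f * g) = \<infinity>"
  using fps_conv_radius_add[of f g] fps_conv_radius_diff[of f g] fps_conv_radius_mult[of f g] assms
  by auto

text \<open>The coefficient of \<open>z^k\<close> on the left is the recursion itself: the second
  and third derivatives contribute \<open>8 (k(k+1) + (k-1)k(k+1)) = 8 k^2 (k+1)\<close> times the
  coefficient of index \<open>k + 1\<close>.\<close>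

lemma X0_series_ode:
  "8 * (z * X0_series 2 z + z\<^sup>2 * X0_series 3 z)
     + (5/2 + 2 * z) * X0_series 1 z - X0_series 0 z = 0"
proof -
  let ?D = "\<lambda>n. (fps_deriv ^^ n) X0_fps"
  have "fps_const 8 * (fps_X * ?D 2 + fps_X ^ 2 * ?D 3)
          + (fps_const (5/2) + fps_const 2 * fps_X) * ?D 1 - ?D 0 = 0" (is "?L = 0")
  proof (rule fps_ext)
    fix k
    \<comment> \<open>Multiplication by \<open>fps_X\<close> and \<open>fps_X ^ 2\<close> shifts
      indices, so the coefficients with \<open>k < 2\<close> are separate cases.\<close>
    consider "k = 0" | "k = 1" | m where "k = Suc (Suc m)"
      by (metis One_nat_def not0_implies_Suc)
    then show "fps_nth ?L k = fps_nth 0 k"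
      using X0_coeff_Suc[of k]
      by cases (simp_all add: numeral_3_eq_3 numeral_2_eq_2 X0_fps_def field_simps del: X0_coeff.simps)
  qed
  then have "eval_fps ?L z = 0" by simp
  then show ?thesis
    by (simp add: X0_series_def eval_fps_add eval_fps_diff eval_fps_mult fps_conv_radius_eq_infinity
        fps_conv_radius_X0_fps del: funpow.simps)
qed

text \<open>With \<open>W = X\<^sub>0' / x\<close> and \<open>\<theta> = x d/dx\<close> this is the first integral
  \<open>(\<theta> W)\<^sup>2 + (x\<^sup>2 + 5/4) W\<^sup>2 - 2 X\<^sub>0 W = -5\<close>.\<close>

lemma X0_series_first_integral:
  "16 * z\<^sup>2 * (X0_series 2 z)\<^sup>2
     + (5 + 4 * z) * (X0_series 1 z)\<^sup>2 - 4 * X0_series 0 z * X0_series 1 z = -5"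
proof -
  let ?E = "\<lambda>z. 16 * z\<^sup>2 * (X0_series 2 z)\<^sup>2
     + (5 + 4 * z) * (X0_series 1 z)\<^sup>2 - 4 * X0_series 0 z * X0_series 1 z"
  have "(?E has_real_derivative 0) (at z)" for z
  proof -
    \<comment> \<open>The terms \<open>4 (X0_series 1 z)^2\<close> cancel, and what remains is a
      multiple of the left side of the differential equation.\<close>
    have "(?E has_real_derivative
        4 * X0_series 2 z * (8 * (z * X0_series 2 z + z\<^sup>2 * X0_series 3 z)
          + (5/2 + 2 * z) * X0_series 1 z - X0_series 0 z)) (at z)"
      by (auto intro!: derivative_eq_intros simp: numeral_3_eq_3 numeral_2_eq_2 algebra_simps)
    then show ?thesis by (simp only: X0_series_ode mult_zero_right)
  qed
  then have "?E z = ?E 0"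
    using DERIV_isconst_all[of ?E] by blast
  \<comment> \<open>The first two coefficients 5/2 and 1 give
    \<open>5 * 1 - 4 * (5/2) * 1\<close>.\<close>
  also have "\<dots> = -5"
    by (simp add: X0_series_def eval_fps_at_0 X0_fps_def power2_eq_square)
  finally show ?thesis .
qed

section \<open>Landau remainders and first-order expansions at 0\<close>

text \<open>Termwise integration of an expansion: after subtracting the monomial, the mean value
  theorem turns the bound on the derivative into one with an extra factor \<open>t\<close>.\<close>

lemma has_derivative_imp_bigo:
  assumes "\<forall>\<^sub>F t in nhds 0. (g has_real_derivative g' t) (at t)"
    and "(\<lambda>t. g' t - real (Suc n) * a * t ^ n) \<in> O[at 0](\<lambda>t. t ^ Suc n)"
  shows "(\<lambda>t. g t - g 0 - a * t ^ Suc n) \<in> O[at 0](\<lambda>t. t ^ Suc (Suc n))"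
proof -
  define k where "k t = g t - a * t ^ Suc n" for t
  define k' where "k' t = g' t - real (Suc n) * a * t ^ n" for t
  obtain C where "C > 0" and C: "\<forall>\<^sub>F t in at 0. norm (k' t) \<le> C * norm (t ^ Suc n)"
    using landau_o.bigE[OF assms(2)] unfolding k'_def by blast
  have "\<forall>\<^sub>F t in nhds 0. (k has_real_derivative k' t) (at t)"
    using assms(1)
  proof eventually_elim
    case (elim t)
    show ?case unfolding k_def k'_def
      by (rule derivative_eq_intros elim refl | simp)+
  qed
  moreover have "\<forall>\<^sub>F t in nhds 0. t \<noteq> 0 \<longrightarrow> norm (k' t) \<le> C * norm (t ^ Suc n)"
    using C by (simp add: eventually_at_filter)
  ultimately have "\<forall>\<^sub>F t in nhds 0. (k has_real_derivative k' t) (at t) \<and>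
      (t \<noteq> 0 \<longrightarrow> norm (k' t) \<le> C * norm (t ^ Suc n))"
    by eventually_elim simp
  then obtain d where "d > 0"
    and d: "\<And>t. \<bar>t\<bar> < d \<Longrightarrow> (k has_real_derivative k' t) (at t) \<and>
      (t \<noteq> 0 \<longrightarrow> norm (k' t) \<le> C * norm (t ^ Suc n))"
    by (auto simp: eventually_nhds_metric dist_real_def)
  have "\<bar>k t - k 0\<bar> \<le> C * \<bar>t ^ Suc (Suc n)\<bar>" if t: "\<bar>t\<bar> < d" "t \<noteq> 0" for t
  proof -
    \<comment> \<open>The bound on \<open>k'\<close> is known only away from 0, so the intermediate
      point has to lie strictly between 0 and \<open>t\<close>.\<close>
    have "\<exists>z. z \<noteq> 0 \<and> \<bar>z\<bar> < \<bar>t\<bar> \<and> k t - k 0 = t * k' z"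
    proof (cases "t > 0")
      case True
      then have "\<exists>z>0. z < t \<and> k t - k 0 = (t - 0) * k' z"
        using t d by (intro MVT2) auto
      then obtain z where "0 < z" "z < t" "k t - k 0 = t * k' z" by auto
      then show ?thesis by (intro exI[of _ z]) auto
    next
      case False
      then have "\<exists>z>t. z < 0 \<and> k 0 - k t = (0 - t) * k' z"
        using t d by (intro MVT2) auto
      then obtain z where "t < z" "z < 0" "k 0 - k t = - t * k' z" by auto
      then show ?thesis by (intro exI[of _ z]) auto
    qed
    then obtain z where z: "z \<noteq> 0" "\<bar>z\<bar> < \<bar>t\<bar>" "k t - k 0 = t * k' z" by blast
    then have "\<bar>k t - k 0\<bar> = \<bar>t\<bar> * \<bar>k' z\<bar>" by (simp add: abs_mult)
    also have "\<dots> \<le> \<bar>t\<bar> * (C * \<bar>z ^ Suc n\<bar>)"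
      using d[of z] z t by (intro mult_left_mono) auto
    also have "\<dots> \<le> \<bar>t\<bar> * (C * \<bar>t\<bar> ^ Suc n)"
      using z \<open>C > 0\<close> power_mono[of "\<bar>z\<bar>" "\<bar>t\<bar>" "Suc n"]
      by (intro mult_left_mono) (auto simp: abs_mult power_abs)
    finally show ?thesis by (simp add: abs_mult power_abs mult_ac)
  qed
  then have "\<forall>\<^sub>F t in at 0. norm (k t - k 0) \<le> C * norm (t ^ Suc (Suc n))"
    using \<open>d > 0\<close> by (auto simp: eventually_at dist_real_def intro!: exI[of _ d])
  then show ?thesis
    by (intro bigoI[of _ C]) (simp add: k_def algebra_simps)
qed

text \<open>As the filter is \<open>at 0\<close>, the value \<open>f 0\<close> itself is not constrained.\<close>

definition jet1 :: "(real \<Rightarrow> real) \<Rightarrow> real \<Rightarrow> real \<Rightarrow> bool" where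
  "jet1 f a b \<longleftrightarrow> (\<lambda>t. f t - a - b * t) \<in> O[at 0](\<lambda>t. t\<^sup>2)"

lemma jet1_const: "jet1 (\<lambda>_. a) a 0"
  by (simp add: jet1_def)

lemma jet1_ident: "jet1 (\<lambda>t. x + t) x 1"
  by (simp add: jet1_def)

lemma bigo_power_le:
  fixes m n :: nat
  assumes "m \<le> n" "f \<in> O[at 0](\<lambda>t::real. t ^ n)"
  shows "f \<in> O[at 0](\<lambda>t::real. t ^ m)"
proof -
  have "\<forall>\<^sub>F t in at 0. \<bar>t\<bar> < (1::real)"
    by (auto simp: eventually_at intro!: exI[of _ 1])
  then have "\<forall>\<^sub>F t in at 0. norm (t ^ n) \<le> 1 * norm (t ^ m :: real)"
    by eventually_elim (use assms(1) in \<open>auto simp: power_abs intro!: power_decreasing\<close>)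
  then have "(\<lambda>t. t ^ n) \<in> O[at 0](\<lambda>t::real. t ^ m)"
    by (rule bigoI)
  then show ?thesis
    using assms(2) landau_o.big_trans by blast
qed

lemma jet1_bigo:
  assumes "jet1 f a b"
  shows "(\<lambda>t. f t - a) \<in> O[at 0](\<lambda>t. t)" and "f \<in> O[at 0](\<lambda>_. 1)" and "(f \<longlongrightarrow> a) (at 0)"
proof -
  have "(\<lambda>t. f t - a - b * t) \<in> O[at 0](\<lambda>t. t)"
    using assms bigo_power_le[of 1 2] unfolding jet1_def by simp
  moreover have "(\<lambda>t. b * t) \<in> O[at 0](\<lambda>t. t)" by simp
  ultimately have "(\<lambda>t. (f t - a - b * t) + b * t) \<in> O[at 0](\<lambda>t. t)"
    by (rule sum_in_bigo)
  then show 1: "(\<lambda>t. f t - a) \<in> O[at 0](\<lambda>t. t)" by simp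
  have "(\<lambda>t. f t - a) \<in> O[at 0](\<lambda>_. 1)"
    using bigo_power_le[of 0 1] 1 by simp
  then have "(\<lambda>t. (f t - a) + a) \<in> O[at 0](\<lambda>_. 1)"
    by (rule sum_in_bigo) simp
  then show "f \<in> O[at 0](\<lambda>_. 1)" by simp
  have "(\<lambda>t. t) \<in> o[at 0](\<lambda>_::real. 1::real)"
    by (intro smalloI_tendsto) (auto intro!: tendsto_eq_intros)
  with 1 have "(\<lambda>t. f t - a) \<in> o[at 0](\<lambda>_. 1)"
    by (rule landau_o.big_small_trans)
  then have "((\<lambda>t. f t - a) \<longlongrightarrow> 0) (at 0)"
    using smalloD_tendsto by fastforce
  then show "(f \<longlongrightarrow> a) (at 0)" by (simp add: LIM_zero_iff)
qed

lemma jet1_add: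
  assumes "jet1 f a b" "jet1 g c d"
  shows "jet1 (\<lambda>t. f t + g t) (a + c) (b + d)"
  using sum_in_bigo(1)[OF assms[unfolded jet1_def]] by (simp add: jet1_def algebra_simps)

lemma jet1_mult:
  assumes f: "jet1 f a b" and g: "jet1 g c d"
  shows "jet1 (\<lambda>t. f t * g t) (a * c) (a * d + b * c)"
proof -
  \<comment> \<open>The remainder of the product splits as
    \<open>(f - a - bt) g + bt (g - c) + a (g - c - dt)\<close>, each summand being
    quadratic.\<close>
  have "(\<lambda>t. (f t - a - b * t) * g t) \<in> O[at 0](\<lambda>t. t\<^sup>2 * 1)"
    using f jet1_bigo(2)[OF g] unfolding jet1_def by (rule landau_o.big.mult)
  moreover have "(\<lambda>t. b * t * (g t - c)) \<in> O[at 0](\<lambda>t. t * t)"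
    using jet1_bigo(1)[OF g] by (intro landau_o.big.mult) auto
  moreover have "(\<lambda>t. a * (g t - c - d * t)) \<in> O[at 0](\<lambda>t. t\<^sup>2)"
    using g unfolding jet1_def by simp
  ultimately have "(\<lambda>t. (f t - a - b * t) * g t + b * t * (g t - c) + a * (g t - c - d * t))
      \<in> O[at 0](\<lambda>t. t\<^sup>2)"
    by (intro sum_in_bigo) (simp_all add: power2_eq_square)
  then show ?thesis by (simp add: jet1_def algebra_simps)
qed

text \<open>The remainder \<open>1/f - 1/a + b t/a^2\<close> is \<open>1/(a^2 f)\<close> times
  \<open>b t (f - a) - a (f - a - b t)\<close>. The latter is quadratic, and \<open>1/f\<close> is
  bounded near 0 because \<open>f\<close> tends to \<open>a \<noteq> 0\<close>.\<close>

lemma jet1_inverse: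
  assumes f: "jet1 f a b" and "a \<noteq> 0"
  shows "jet1 (\<lambda>t. inverse (f t)) (inverse a) (- b / a\<^sup>2)"
proof -
  have "((\<lambda>t. inverse (f t)) \<longlongrightarrow> inverse a) (at 0)"
    using jet1_bigo(3)[OF f] \<open>a \<noteq> 0\<close> by (intro tendsto_inverse)
  then have inv: "(\<lambda>t. inverse (f t)) \<in> O[at 0](\<lambda>_. 1)"
    by (intro bigoI_tendsto) auto
  have "(\<lambda>t. b * t * (f t - a)) \<in> O[at 0](\<lambda>t. t * t)"
    using jet1_bigo(1)[OF f] by (intro landau_o.big.mult) auto
  moreover have "(\<lambda>t. a * (f t - a - b * t)) \<in> O[at 0](\<lambda>t. t\<^sup>2)"
    using f unfolding jet1_def by simp
  ultimately have "(\<lambda>t. b * t * (f t - a) - a * (f t - a - b * t)) \<in> O[at 0](\<lambda>t. t\<^sup>2)"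
    by (intro sum_in_bigo) (simp_all add: power2_eq_square)
  then have "(\<lambda>t. inverse (a\<^sup>2) * (b * t * (f t - a) - a * (f t - a - b * t)))
      \<in> O[at 0](\<lambda>t. t\<^sup>2)"
    by simp
  from landau_o.big.mult[OF this inv]
  have O: "(\<lambda>t. inverse (a\<^sup>2) * (b * t * (f t - a) - a * (f t - a - b * t)) * inverse (f t))
      \<in> O[at 0](\<lambda>t. t\<^sup>2)"
    by simp
  have "\<forall>\<^sub>F t in at 0. f t \<noteq> 0"
    using jet1_bigo(3)[OF f] \<open>a \<noteq> 0\<close> by (rule tendsto_imp_eventually_ne)
  then have "\<forall>\<^sub>F t in at 0. inverse (a\<^sup>2) * (b * t * (f t - a) - a * (f t - a - b * t)) * inverse (f t)
      = inverse (f t) - inverse a - (- b / a\<^sup>2) * t"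
  proof eventually_elim
    case (elim t)
    \<comment> \<open>Naming the inverses makes the identity polynomial modulo
      \<open>a * p = 1\<close> and \<open>f t * q = 1\<close>.\<close>
    define p q where "p = inverse a" and "q = inverse (f t)"
    have "a * p = 1" "f t * q = 1"
      using elim \<open>a \<noteq> 0\<close> by (simp_all add: p_def q_def)
    then have "p\<^sup>2 * (b * t * (f t - a) - a * (f t - a - b * t)) * q = q - p + b * p\<^sup>2 * t"
      by algebra
    then show ?case
      by (simp add: p_def q_def divide_inverse power_inverse)
  qed
  from landau_o.big.in_cong[OF this] O show ?thesis
    unfolding jet1_def by (simp only:)
qed

text \<open>Differentiability of \<open>f'\<close> at \<open>x\<close> bounds
  \<open>f' (x + t) - f' x\<close> by a multiple of \<open>t\<close>; integrating this gives the
  quadratic remainder.\<close>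

lemma derivative_imp_jet1:
  assumes "\<forall>\<^sub>F t in nhds x. (f has_real_derivative f' t) (at t)"
    and "(f' has_real_derivative c) (at x)"
  shows "jet1 (\<lambda>t. f (x + t)) (f x) (f' x)"
proof -
  have "filterlim (\<lambda>t. x + t) (nhds x) (nhds 0)"
    by (auto intro!: tendsto_eq_intros filterlim_ident)
  then have "\<forall>\<^sub>F t in nhds 0. (f has_real_derivative f' (x + t)) (at (x + t))"
    using assms(1) by (rule eventually_compose_filterlim[rotated])
  then have "\<forall>\<^sub>F t in nhds 0. ((\<lambda>t. f (x + t)) has_real_derivative f' (x + t)) (at t)"
    by eventually_elim (simp add: DERIV_shift add.commute)
  moreover have "(\<lambda>t. f' (x + t) - real (Suc 0) * f' x * t ^ 0) \<in> O[at 0](\<lambda>t. t ^ Suc 0)"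
  proof -
    have "((\<lambda>t. (f' (x + t) - f' x) / t) \<longlongrightarrow> c) (at 0)"
      using assms(2) by (simp add: DERIV_def)
    then have "(\<lambda>t. f' (x + t) - f' x) \<in> O[at 0](\<lambda>t. t)"
      by (intro bigoI_tendsto[where c = c]) (auto simp: eventually_at_filter)
    then show ?thesis by simp
  qed
  ultimately have "(\<lambda>t. f (x + t) - f (x + 0) - f' x * t ^ Suc 0) \<in> O[at 0](\<lambda>t. t ^ Suc (Suc 0))"
    by (rule has_derivative_imp_bigo)
  then show ?thesis by (simp add: jet1_def numeral_2_eq_2)
qed

section \<open>A cusp criterion for framed curves\<close>

lemma inner_shift_has_derivative:
  fixes p :: "real \<Rightarrow> 'a::real_inner"
  assumes "(p has_vector_derivative q) (at (s + t))"
  shows "((\<lambda>t. (p (s + t) - c) \<bullet> e) has_real_derivative q \<bullet> e) (at t)"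
proof -
  have "((\<lambda>t. s + t) has_vector_derivative 1) (at t)"
    by (auto intro!: derivative_eq_intros)
  from vector_diff_chain_at[OF this, of p q] assms
  have "((\<lambda>t. p (s + t)) has_vector_derivative q) (at t)"
    by (simp add: o_def)
  then show ?thesis
    unfolding has_field_derivative_def has_vector_derivative_def
    by (auto intro!: derivative_eq_intros simp: mult.commute)
qed

text \<open>In the Frenet axes at \<open>t0\<close> the components of \<open>v\<close> begin with
  \<open>1\<close>, \<open>r t\<close> and \<open>D t^2/2\<close>, where
  \<open>r^2 = K0^2 + L0^2\<close> and \<open>r D = K0 L1 - L0 K1\<close>. Multiplying by
  \<open>u\<close>, which begins with \<open>u1 t\<close>, and integrating yields the orders 2, 3
  and 4 with coefficients \<open>u1/2\<close>, \<open>u1 r/3\<close> and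
  \<open>u1 D/8\<close>.\<close>

lemma cusp_234_of_framed_curve:
  fixes p v m w :: "real \<Rightarrow> 'a::euclidean_space"
  assumes dim: "DIM('a) = 4"
    and I: "open I" "is_interval I" "t0 \<in> I"
    and p': "\<And>t. t \<in> I \<Longrightarrow> (p has_vector_derivative u t *\<^sub>R v t) (at t)"
    and v': "\<And>t. t \<in> I \<Longrightarrow> (v has_vector_derivative K t *\<^sub>R m t + L t *\<^sub>R w t) (at t)"
    and m': "\<And>t. t \<in> I \<Longrightarrow> (m has_vector_derivative - K t *\<^sub>R v t) (at t)"
    and w': "\<And>t. t \<in> I \<Longrightarrow> (w has_vector_derivative - L t *\<^sub>R v t) (at t)"
    and orth: "orthonormal_list [v t0, m t0, w t0]"
    and n': "\<And>t. t \<in> I \<Longrightarrow> (n has_vector_derivative 0) (at t)"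
    and n: "n t0 \<noteq> 0" "\<And>t. t \<in> I \<Longrightarrow> n t \<bullet> v t = 0" "n t0 \<bullet> m t0 = 0" "n t0 \<bullet> w t0 = 0"
    and u: "jet1 (\<lambda>t. u (t0 + t)) 0 u1" "u1 \<noteq> 0"
    and K: "jet1 (\<lambda>t. K (t0 + t)) K0 K1"
    and L: "jet1 (\<lambda>t. L (t0 + t)) L0 L1"
    and KL: "K0 * L1 - L0 * K1 \<noteq> 0"
  shows "\<exists>V. cusp_234_in V I p t0"
proof -
  let ?n = "n t0"
  define V where "V = {z. ?n \<bullet> z = ?n \<bullet> p t0}"
  have n_const: "n t = ?n" if t: "t \<in> I" for t
  proof -
    obtain c where c: "\<And>t. t \<in> I \<Longrightarrow> n t = c"
    proof (rule has_vector_derivative_zero_constant)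
      show "convex I" using I(2) is_interval_convex by blast
      show "(n has_vector_derivative 0) (at t within I)" if "t \<in> I" for t
        using n'[OF that] by (rule has_vector_derivative_at_within)
    qed blast
    show ?thesis using c[OF t] c[OF I(3)] by simp
  qed
  \<comment> \<open>The derivative of \<open>?n \<bullet> p\<close> is \<open>u\<close> times
    \<open>?n \<bullet> v\<close>, which vanishes because \<open>n\<close> is constant; so the curve
    stays in the hyperplane \<open>V\<close>.\<close>
  have "\<exists>c. \<forall>t\<in>I. ?n \<bullet> p t = c"
  proof (rule has_derivative_zero_constant)
    show "convex I" using I(2) is_interval_convex by blast
    show "((\<lambda>t. ?n \<bullet> p t) has_derivative (\<lambda>_. 0)) (at t within I)" if "t \<in> I" for t
    proof -
      have "?n \<bullet> v t = 0"
        using n(2)[OF that] by (simp only: n_const[OF that])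
      with has_derivative_inner_right[OF p'[OF that, unfolded has_vector_derivative_def], of ?n]
      have "((\<lambda>t. ?n \<bullet> p t) has_derivative (\<lambda>_. 0)) (at t)"
        by simp
      then show ?thesis by (rule has_derivative_at_withinI)
    qed
  qed
  then have "p ` I \<subseteq> V"
    using I(3) by (force simp: V_def)
  moreover have "affine V" "aff_dim V = 3"
    using n(1) dim by (simp_all add: V_def affine_hyperplane)
  moreover have "t0 \<in> interior I"
    using I by (simp add: interior_open)
  moreover have "\<exists>e1 e2 e3. \<exists>a b c :: real.
        orthonormal_list [e1, e2, e3] \<and> p t0 + e1 \<in> V \<and> p t0 + e2 \<in> V \<and> p t0 + e3 \<in> V \<and>
        a * b * c \<noteq> 0 \<and>
        (\<lambda>t. (p (t0 + t) - p t0) \<bullet> e1 - a * t ^ 2) \<in> O[at 0](\<lambda>t. t ^ 3) \<and>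
        (\<lambda>t. (p (t0 + t) - p t0) \<bullet> e2 - b * t ^ 3) \<in> O[at 0](\<lambda>t. t ^ 4) \<and>
        (\<lambda>t. (p (t0 + t) - p t0) \<bullet> e3 - c * t ^ 4) \<in> O[at 0](\<lambda>t. t ^ 5)"
  proof -
    \<comment> \<open>\<open>r\<close> is the length of the derivative \<open>K0 m + L0 w\<close> of
      \<open>v\<close> at \<open>t0\<close>, and \<open>(k, l)\<close> below is its direction;
      \<open>KL\<close> excludes \<open>r = 0\<close>.\<close>
    define r where "r = sqrt (K0\<^sup>2 + L0\<^sup>2)"
    have "K0 \<noteq> 0 \<or> L0 \<noteq> 0" using KL by auto
    then have "K0\<^sup>2 + L0\<^sup>2 > 0" by (simp add: sum_power2_gt_zero_iff)
    then have "r > 0" and r2: "r\<^sup>2 = K0\<^sup>2 + L0\<^sup>2" by (simp_all add: r_def)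
    define k l where "k = K0 / r" and "l = L0 / r"
    have K0: "K0 = r * k" and L0: "L0 = r * l"
      using \<open>r > 0\<close> by (simp_all add: k_def l_def)
    have "k\<^sup>2 + l\<^sup>2 = (K0\<^sup>2 + L0\<^sup>2) / r\<^sup>2"
      by (simp add: k_def l_def power_divide add_divide_distrib)
    then have kl: "k\<^sup>2 + l\<^sup>2 = 1"
      using \<open>r > 0\<close> by (simp flip: r2)
    \<comment> \<open>the axes are the Frenet frame of the curve at \<open>t0\<close>\<close>
    define e1 e2 e3 where "e1 = v t0" and "e2 = k *\<^sub>R m t0 + l *\<^sub>R w t0"
      and "e3 = k *\<^sub>R w t0 - l *\<^sub>R m t0"
    have ips: "v t0 \<bullet> v t0 = 1" "m t0 \<bullet> m t0 = 1" "w t0 \<bullet> w t0 = 1" "v t0 \<bullet> m t0 = 0"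
        "m t0 \<bullet> v t0 = 0" "v t0 \<bullet> w t0 = 0" "w t0 \<bullet> v t0 = 0" "m t0 \<bullet> w t0 = 0" "w t0 \<bullet> m t0 = 0"
      using orth by (auto simp: orthonormal_list_def All_less_Suc numeral_3_eq_3 numeral_2_eq_2)
    have near: "\<forall>\<^sub>F t in nhds 0. t0 + t \<in> I"
    proof -
      have "filterlim (\<lambda>t. t0 + t) (nhds t0) (nhds 0)"
        by (auto intro!: tendsto_eq_intros filterlim_ident)
      then show ?thesis
        using eventually_nhds_in_open[OF I(1,3)] by (rule eventually_compose_filterlim[rotated])
    qed
    \<comment> \<open>Componentwise integration: a leading term of order \<open>i\<close> in the
      derivative \<open>q'\<close> becomes one of order \<open>i + 1\<close> in
      \<open>q\<close>.\<close>
    have step: "(\<lambda>t. (q (t0 + t) - q t0) \<bullet> e - a * t ^ Suc i) \<in> O[at 0](\<lambda>t. t ^ Suc (Suc i))"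
      if "\<And>t. t \<in> I \<Longrightarrow> (q has_vector_derivative q' t) (at t)"
        "(\<lambda>t. q' (t0 + t) \<bullet> e - real (Suc i) * a * t ^ i) \<in> O[at 0](\<lambda>t. t ^ Suc i)"
      for q q' :: "real \<Rightarrow> 'a" and e a i
    proof -
      have "\<forall>\<^sub>F t in nhds 0. ((\<lambda>t. (q (t0 + t) - q t0) \<bullet> e) has_real_derivative q' (t0 + t) \<bullet> e) (at t)"
        using near by eventually_elim (intro inner_shift_has_derivative that)
      from has_derivative_imp_bigo[OF this that(2)] show ?thesis by simp
    qed
    have lip: "(\<lambda>t. (q (t0 + t) - q t0) \<bullet> e) \<in> O[at 0](\<lambda>t. t)"
      if "(q has_vector_derivative q') (at t0)"
      for q :: "real \<Rightarrow> 'a" and q' e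
    proof -
      have "((\<lambda>t. (q (t0 + t) - q t0) \<bullet> e) has_real_derivative q' \<bullet> e) (at 0)"
        by (rule inner_shift_has_derivative) (use that in simp)
      then have "((\<lambda>t. (q (t0 + t) - q t0) \<bullet> e / t) \<longlongrightarrow> q' \<bullet> e) (at 0)"
        by (simp add: DERIV_def)
      then show ?thesis
        by (intro bigoI_tendsto[where c = "q' \<bullet> e"]) (auto simp: eventually_at_filter)
    qed
    note u_lin = jet1_bigo(1)[OF u(1), simplified]
    note Kb = jet1_bigo(2)[OF K] and Lb = jet1_bigo(2)[OF L]
    \<comment> \<open>Multiplication by \<open>u\<close> and integration each raise the order by
      one; the integration divides by \<open>i + 2\<close>.\<close>
    have p_step: "(\<lambda>t. (p (t0 + t) - p t0) \<bullet> e - u1 * a / (real i + 2) * t ^ (i + 2)) \<in> O[at 0](\<lambda>t. t ^ (i + 3))"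
      if v: "(\<lambda>t. v (t0 + t) \<bullet> e - a * t ^ i) \<in> O[at 0](\<lambda>t. t ^ Suc i)" for e a i
    proof -
      have "(\<lambda>t. u (t0 + t) * (v (t0 + t) \<bullet> e - a * t ^ i)) \<in> O[at 0](\<lambda>t. t * t ^ Suc i)"
        using u_lin v by (rule landau_o.big.mult)
      moreover have "(\<lambda>t. (u (t0 + t) - u1 * t) * (a * t ^ i)) \<in> O[at 0](\<lambda>t. t\<^sup>2 * t ^ i)"
        using u(1) by (intro landau_o.big.mult) (auto simp: jet1_def)
      ultimately have "(\<lambda>t. u (t0 + t) * (v (t0 + t) \<bullet> e - a * t ^ i) + (u (t0 + t) - u1 * t) * (a * t ^ i))
          \<in> O[at 0](\<lambda>t. t ^ Suc (Suc i))"
        by (intro sum_in_bigo) (simp_all add: power2_eq_square mult_ac)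
      moreover have "u (t0 + t) * (v (t0 + t) \<bullet> e - a * t ^ i) + (u (t0 + t) - u1 * t) * (a * t ^ i)
          = (u (t0 + t) *\<^sub>R v (t0 + t)) \<bullet> e - real (Suc (Suc i)) * (u1 * a / (real i + 2)) * t ^ Suc i" for t
      proof -
        have "real (Suc (Suc i)) * (u1 * a / (real i + 2)) = u1 * a" by (simp add: field_simps)
        then show ?thesis by (simp only:) (simp add: algebra_simps)
      qed
      ultimately show ?thesis
        using step[OF p', where i = "Suc i" and e = e and a = "u1 * a / (real i + 2)"]
        by (simp add: numeral_3_eq_3)
    qed
    have frame_lip: "(\<lambda>t. m (t0 + t) \<bullet> e - m t0 \<bullet> e) \<in> O[at 0](\<lambda>t. t)"
        "(\<lambda>t. w (t0 + t) \<bullet> e - w t0 \<bullet> e) \<in> O[at 0](\<lambda>t. t)"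
        "(\<lambda>t. v (t0 + t) \<bullet> e - v t0 \<bullet> e) \<in> O[at 0](\<lambda>t. t)" for e
      using lip[OF m'[OF I(3)], of e] lip[OF w'[OF I(3)], of e] lip[OF v'[OF I(3)], of e]
      by (simp_all add: inner_diff_left)
    have v1: "(\<lambda>t. v (t0 + t) \<bullet> e1 - 1 * t ^ 0) \<in> O[at 0](\<lambda>t. t ^ Suc 0)"
      using frame_lip(3)[of e1] by (simp add: e1_def ips)
    have v2: "(\<lambda>t. v (t0 + t) \<bullet> e2 - r * t ^ 1) \<in> O[at 0](\<lambda>t. t ^ Suc 1)"
    proof -
      have ip: "m t0 \<bullet> e2 = k" "w t0 \<bullet> e2 = l" "v t0 \<bullet> e2 = 0"
        by (simp_all add: e2_def inner_add_right ips)
      \<comment> \<open>The slope of the \<open>e2\<close>-component of \<open>v\<close> at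
        \<open>t0\<close> is \<open>K0 * k + L0 * l\<close>, the projection of the derivative of
        \<open>v\<close> onto its own direction.\<close>
      have "K0 * k + L0 * l = r * (k\<^sup>2 + l\<^sup>2)"
        by (simp add: K0 L0 power2_eq_square algebra_simps)
      then have r: "r = K0 * k + L0 * l" using kl by simp
      have "(\<lambda>t. K (t0 + t) * (m (t0 + t) \<bullet> e2 - k)) \<in> O[at 0](\<lambda>t. 1 * t)"
        "(\<lambda>t. L (t0 + t) * (w (t0 + t) \<bullet> e2 - l)) \<in> O[at 0](\<lambda>t. 1 * t)"
        using frame_lip(1,2)[of e2] by (intro landau_o.big.mult Kb Lb; simp add: ip)+
      moreover have "(\<lambda>t. k * (K (t0 + t) - K0)) \<in> O[at 0](\<lambda>t. t)"
        "(\<lambda>t. l * (L (t0 + t) - L0)) \<in> O[at 0](\<lambda>t. t)"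
        using jet1_bigo(1)[OF K] jet1_bigo(1)[OF L] by simp_all
      ultimately have "(\<lambda>t. K (t0 + t) * (m (t0 + t) \<bullet> e2 - k) + L (t0 + t) * (w (t0 + t) \<bullet> e2 - l)
          + k * (K (t0 + t) - K0) + l * (L (t0 + t) - L0)) \<in> O[at 0](\<lambda>t. t)"
        by (intro sum_in_bigo) simp_all
      then have "(\<lambda>t. (K (t0 + t) *\<^sub>R m (t0 + t) + L (t0 + t) *\<^sub>R w (t0 + t)) \<bullet> e2
          - real (Suc 0) * r * t ^ 0) \<in> O[at 0](\<lambda>t. t ^ Suc 0)"
        by (simp add: r algebra_simps inner_add_left)
      from step[OF v' this] show ?thesis by (simp add: inner_diff_left ip)
    qed
    \<comment> \<open>\<open>D\<close> is the \<open>e3\<close>-component of the second derivative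
      of \<open>v\<close> at \<open>t0\<close>; the derivatives of \<open>m\<close> and
      \<open>w\<close> are multiples of \<open>v\<close> there and do not contribute.\<close>
    define D where "D = (K0 * L1 - L0 * K1) / r"
    have v3: "(\<lambda>t. v (t0 + t) \<bullet> e3 - D / 2 * t ^ 2) \<in> O[at 0](\<lambda>t. t ^ Suc 2)"
    proof -
      have ip: "m t0 \<bullet> e3 = - l" "w t0 \<bullet> e3 = k" "v t0 \<bullet> e3 = 0"
        by (simp_all add: e3_def inner_diff_right ips)
      \<comment> \<open>A bootstrap: \<open>v \<bullet> e3\<close> is \<open>O(t)\<close>, so the
        derivatives of \<open>m \<bullet> e3\<close> and \<open>w \<bullet> e3\<close> are
        \<open>O(t)\<close> too. These components are therefore constant up to
        \<open>O(t^2)\<close>, and the linear term of the derivative of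
        \<open>v \<bullet> e3\<close> comes from \<open>K1\<close> and \<open>L1\<close>
        alone.\<close>
      have "(\<lambda>t. v (t0 + t) \<bullet> e3) \<in> O[at 0](\<lambda>t. t)"
        using frame_lip(3)[of e3] by (simp add: ip)
      then have "(\<lambda>t. K (t0 + t) * (v (t0 + t) \<bullet> e3)) \<in> O[at 0](\<lambda>t. 1 * t)"
        "(\<lambda>t. L (t0 + t) * (v (t0 + t) \<bullet> e3)) \<in> O[at 0](\<lambda>t. 1 * t)"
        by (intro landau_o.big.mult Kb Lb; simp)+
      then have "(\<lambda>t. (- K (t0 + t) *\<^sub>R v (t0 + t)) \<bullet> e3 - real (Suc 0) * 0 * t ^ 0) \<in> O[at 0](\<lambda>t. t ^ Suc 0)"
        "(\<lambda>t. (- L (t0 + t) *\<^sub>R v (t0 + t)) \<bullet> e3 - real (Suc 0) * 0 * t ^ 0) \<in> O[at 0](\<lambda>t. t ^ Suc 0)"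
        by simp_all
      from step[OF m' this(1)] step[OF w' this(2)]
      have "(\<lambda>t. m (t0 + t) \<bullet> e3 + l) \<in> O[at 0](\<lambda>t. t\<^sup>2)" "(\<lambda>t. w (t0 + t) \<bullet> e3 - k) \<in> O[at 0](\<lambda>t. t\<^sup>2)"
        by (simp_all add: inner_diff_left ip numeral_2_eq_2)
      then have "(\<lambda>t. K (t0 + t) * (m (t0 + t) \<bullet> e3 + l)) \<in> O[at 0](\<lambda>t. 1 * t\<^sup>2)"
        "(\<lambda>t. L (t0 + t) * (w (t0 + t) \<bullet> e3 - k)) \<in> O[at 0](\<lambda>t. 1 * t\<^sup>2)"
        by (intro landau_o.big.mult Kb Lb; simp)+
      moreover have "(\<lambda>t. l * (K (t0 + t) - K0 - K1 * t)) \<in> O[at 0](\<lambda>t. t\<^sup>2)"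
        "(\<lambda>t. k * (L (t0 + t) - L0 - L1 * t)) \<in> O[at 0](\<lambda>t. t\<^sup>2)"
        using K L by (simp_all add: jet1_def)
      ultimately have "(\<lambda>t. K (t0 + t) * (m (t0 + t) \<bullet> e3 + l) + L (t0 + t) * (w (t0 + t) \<bullet> e3 - k)
          - l * (K (t0 + t) - K0 - K1 * t) + k * (L (t0 + t) - L0 - L1 * t)) \<in> O[at 0](\<lambda>t. t\<^sup>2)"
        by (intro sum_in_bigo) simp_all
      moreover have D: "D = k * L1 - l * K1"
        by (simp add: D_def k_def l_def diff_divide_distrib)
      have "K (t0 + t) * (m (t0 + t) \<bullet> e3 + l) + L (t0 + t) * (w (t0 + t) \<bullet> e3 - k)
          - l * (K (t0 + t) - K0 - K1 * t) + k * (L (t0 + t) - L0 - L1 * t)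
          = (K (t0 + t) *\<^sub>R m (t0 + t) + L (t0 + t) *\<^sub>R w (t0 + t)) \<bullet> e3
            - real (Suc 1) * (D / 2) * t ^ 1" for t
        by (simp add: D K0 L0 algebra_simps diff_divide_distrib inner_add_left)
      ultimately have "(\<lambda>t. (K (t0 + t) *\<^sub>R m (t0 + t) + L (t0 + t) *\<^sub>R w (t0 + t)) \<bullet> e3
            - real (Suc 1) * (D / 2) * t ^ 1) \<in> O[at 0](\<lambda>t. t ^ Suc 1)"
        by (simp only: numeral_2_eq_2 One_nat_def)
      from step[OF v' this] show ?thesis by (simp add: inner_diff_left ip numeral_2_eq_2)
    qed
    have "orthonormal_list [e1, e2, e3]"
      using kl by (auto simp: orthonormal_list_def All_less_Suc numeral_3_eq_3 e1_def e2_def e3_def ips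
          inner_add_left inner_add_right inner_diff_left inner_diff_right power2_eq_square algebra_simps)
    moreover have "p t0 + e1 \<in> V" "p t0 + e2 \<in> V" "p t0 + e3 \<in> V"
      using n(2)[OF I(3)] n(3,4)
      by (simp_all add: V_def e1_def e2_def e3_def inner_add_right inner_diff_right)
    \<comment> \<open>The coefficients are \<open>u1 * a / (i + 2)\<close> from
      \<open>p_step\<close> with \<open>i = 0, 1, 2\<close> and
      \<open>a = 1, r, D/2\<close>.\<close>
    moreover have "(u1 / 2) * (u1 * r / 3) * (u1 * D / 8) \<noteq> 0"
      using u(2) KL \<open>r > 0\<close> by (simp add: D_def)
    moreover have "(\<lambda>t. (p (t0 + t) - p t0) \<bullet> e1 - u1 / 2 * t ^ 2) \<in> O[at 0](\<lambda>t. t ^ 3)"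
      using p_step[OF v1] by (simp add: power2_eq_square)
    moreover have "(\<lambda>t. (p (t0 + t) - p t0) \<bullet> e2 - u1 * r / 3 * t ^ 3) \<in> O[at 0](\<lambda>t. t ^ 4)"
      using p_step[OF v2] by (simp add: power3_eq_cube mult.assoc)
    moreover have "(\<lambda>t. (p (t0 + t) - p t0) \<bullet> e3 - u1 * D / 8 * t ^ 4) \<in> O[at 0](\<lambda>t. t ^ 5)"
      using p_step[OF v3] by simp
    ultimately show ?thesis
      by (intro exI[of _ e1] exI[of _ e2] exI[of _ e3] exI[of _ "u1 / 2"] exI[of _ "u1 * r / 3"]
          exI[of _ "u1 * D / 8"] conjI) assumption+
  qed
  ultimately show ?thesis
    unfolding cusp_234_in_def by (intro exI[of _ V] conjI)
qed

lemma has_vector_derivative_lincomb: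
  assumes "(f has_vector_derivative f') (at t)" "(g has_vector_derivative g') (at t)"
  shows "((\<lambda>t. a *\<^sub>R f t + b *\<^sub>R g t) has_vector_derivative a *\<^sub>R f' + b *\<^sub>R g') (at t)"
  by (intro has_vector_derivative_add
      bounded_linear.has_vector_derivative[OF bounded_linear_scaleR_right] assms)

section \<open>Positivity of \<open>X0\<close> and \<open>X0' x / x\<close> from the first
  integral\<close>

lemma X0_has_derivative: "(X0 has_real_derivative 2 * x * X0_series 1 (x\<^sup>2)) (at x)"
  unfolding X0_eq_series[abs_def] by (auto intro!: derivative_eq_intros)

lemma X0'_eq: "X0' x = 2 * x * X0_series 1 (x\<^sup>2)"
  using X0_has_derivative by (rule DERIV_imp_deriv)

lemma X0'_div_eq: "x \<noteq> 0 \<Longrightarrow> X0' x / x = 2 * X0_series 1 (x\<^sup>2)"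
  by (simp add: X0'_eq)

text \<open>At a zero the first integral would equate a nonnegative number with -5. So there is no
  zero, and the value 1 at 0 fixes the sign by the intermediate value theorem.\<close>

lemma X0_series_1_pos:
  assumes "z \<ge> 0"
  shows "X0_series 1 z > 0"
proof (rule ccontr)
  have nz: "X0_series 1 t \<noteq> 0" for t
  proof
    assume "X0_series 1 t = 0"
    then have "16 * t\<^sup>2 * (X0_series 2 t)\<^sup>2 = - 5"
      using X0_series_first_integral[of t] by simp
    moreover have "16 * t\<^sup>2 * (X0_series 2 t)\<^sup>2 \<ge> 0" by simp
    ultimately show False by linarith
  qed
  assume "\<not> X0_series 1 z > 0"
  moreover have "X0_series 1 0 = 1"
    by (simp add: X0_series_def eval_fps_at_0 X0_fps_def)
  moreover have "isCont (X0_series 1) t" for t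
    using X0_series_has_derivative[OF DERIV_ident, of 1] by (rule DERIV_isCont)
  ultimately have "\<exists>t\<ge>0. t \<le> z \<and> X0_series 1 t = 0"
    using assms by (intro IVT2) auto
  with nz show False by blast
qed

text \<open>The first integral writes \<open>(X0_series 0 z - z X0_series 1 z) X0_series 1 z\<close>
  as a sum of squares plus a positive constant. With \<open>z = x^2\<close> the inequality makes
  \<open>h x 0\<close> positive.\<close>

lemma X0_series_0_gt:
  assumes "z \<ge> 0"
  shows "X0_series 0 z > z * X0_series 1 z"
proof -
  have "0 < 16 * (z\<^sup>2 * (X0_series 2 z)\<^sup>2) + 5 * (X0_series 1 z)\<^sup>2 + 5"
    by (simp add: add_nonneg_pos)
  also have "\<dots> = 4 * ((X0_series 0 z - z * X0_series 1 z) * X0_series 1 z)"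
    using X0_series_first_integral[of z] by (simp add: power2_eq_square algebra_simps)
  finally show ?thesis
    using X0_series_1_pos[OF assms] by (simp add: zero_less_mult_iff)
qed

lemma X0_series_0_pos: "z \<ge> 0 \<Longrightarrow> X0_series 0 z > 0"
  using X0_series_0_gt[of z] X0_series_1_pos[of z] by (smt (verit) mult_nonneg_nonneg)

text \<open>The slope can stay unspecified because such slopes cancel in the cusp condition for the
  x-curves.\<close>

lemma ex_jet1_X0_series_square: "\<exists>b. jet1 (\<lambda>t. X0_series n ((x + t)\<^sup>2)) (X0_series n (x\<^sup>2)) b"
proof -
  define f' where "f' t = X0_series (Suc n) (t\<^sup>2) * (2 * t)" for t
  have "((\<lambda>x. X0_series n (x\<^sup>2)) has_real_derivative f' t) (at t)" for t
    unfolding f'_def by (auto intro!: derivative_eq_intros)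
  moreover have "\<exists>c. (f' has_real_derivative c) (at x)"
    unfolding f'_def by (rule exI) (rule derivative_eq_intros refl)+
  ultimately show ?thesis
    using derivative_imp_jet1[of "\<lambda>x. X0_series n (x\<^sup>2)" f' x] by auto
qed

text \<open>This clears the division by \<open>x\<close> and is built only from sums and products,
  with \<open>+ - 1 *\<close> for subtraction, so that the jet rules compose to exactly this
  term.\<close>

lemma times_h_eq:
  "x * h x y = x * (2 * ((X0_series 0 (x\<^sup>2) + sqrt 5 / 2) + - 1 * ((x * x + - y\<^sup>2) * X0_series 1 (x\<^sup>2))))"
  by (cases "x = 0") (simp_all add: h_def X0_eq_series X0'_eq power2_eq_square algebra_simps)

lemma orthonormal_frame_inner:
  assumes "orthonormal_list [a, b, c, d]"
  shows "a \<bullet> a = 1" "b \<bullet> b = 1" "c \<bullet> c = 1" "d \<bullet> d = 1"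
    "a \<bullet> b = 0" "a \<bullet> c = 0" "a \<bullet> d = 0" "b \<bullet> a = 0" "b \<bullet> c = 0" "b \<bullet> d = 0"
    "c \<bullet> a = 0" "c \<bullet> b = 0" "c \<bullet> d = 0" "d \<bullet> a = 0" "d \<bullet> b = 0" "d \<bullet> c = 0"
  using assms by (auto simp: orthonormal_list_def All_less_Suc eval_nat_numeral)

section \<open>Cusps of the x-curves\<close>

text \<open>As \<open>a1 = - y * c1\<close>, the derivative of \<open>X\<alpha>\<close> is
  \<open>- c1 (y \<phi> + X\<beta>) - b1 \<xi>\<close>, so \<open>m\<close> is the normalised
  \<open>y \<phi> + X\<beta>\<close> and \<open>w\<close> is \<open>\<xi>\<close>. Up to the common
  factor \<open>1/(x h)\<close>, \<open>K\<close> is a constant multiple of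
  \<open>S = X0 + sqrt 5 / 2\<close> and \<open>L\<close> is \<open>S\<close> plus a term with a
  simple zero at \<open>x = |y|\<close>, which keeps the two from being proportional to first
  order.\<close>

lemma x_curve_cusp:
  fixes f \<phi> X\<alpha> X\<beta> \<xi> :: "real \<times> real \<Rightarrow> real^4"
  assumes frame: "frame_field \<phi> X\<alpha> X\<beta> \<xi>"
    and f': "\<And>x. x > 0 \<Longrightarrow> ((\<lambda>s. f (s, y)) has_vector_derivative
               ((x\<^sup>2 - y\<^sup>2) / (x * h x y)) *\<^sub>R X\<alpha> (x, y)) (at x)"
    and "y \<noteq> 0"
  shows "\<exists>V. cusp_234_in V {0<..} (\<lambda>x. f (x, y)) \<bar>y\<bar>"
proof -
  define s where "s = sqrt (1 + y\<^sup>2)"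
  have "s > 0" and s2: "s * s = 1 + y\<^sup>2"
    by (simp_all add: s_def add_pos_nonneg)
  note F = frame[unfolded frame_field_def half_plane_def, THEN conjunct2, THEN conjunct2,
      THEN conjunct2, THEN conjunct2, simplified, rule_format]
  have a1: "a1 x y = - y * c1 x y" for x
    by (simp add: a1_def c1_def)
  \<comment> \<open>With \<open>x = |y| + t\<close>, the three building blocks are \<open>S\<close>
    for \<open>X0 x + sqrt 5 / 2\<close>, \<open>r\<close> for \<open>x^2 - y^2\<close> and
    \<open>q\<close> for \<open>1/(x h)\<close>.\<close>
  define S where "S t = X0_series 0 ((\<bar>y\<bar> + t)\<^sup>2) + sqrt 5 / 2" for t
  define r where "r t = (\<bar>y\<bar> + t) * (\<bar>y\<bar> + t) + - y\<^sup>2" for t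
  define q where "q t = inverse ((\<bar>y\<bar> + t) * (2 * (S t + - 1 * (r t * X0_series 1 ((\<bar>y\<bar> + t)\<^sup>2)))))" for t
  have q: "1 / ((\<bar>y\<bar> + t) * h (\<bar>y\<bar> + t) y) = q t" for t
    unfolding times_h_eq by (simp add: q_def S_def r_def inverse_eq_divide)
  obtain S0 S1 where S: "jet1 S S0 S1" and "S0 > 0"
  proof -
    obtain b where "jet1 (\<lambda>t. X0_series 0 ((\<bar>y\<bar> + t)\<^sup>2)) (X0_series 0 (\<bar>y\<bar>\<^sup>2)) b"
      using ex_jet1_X0_series_square by blast
    from jet1_add[OF this jet1_const[of "sqrt 5 / 2"]] show ?thesis
      using that X0_series_0_pos[of "y\<^sup>2"] unfolding S_def[abs_def] by (simp add: add_pos_nonneg)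
  qed
  have r: "jet1 r 0 (2 * \<bar>y\<bar>)"
    using jet1_add[OF jet1_mult[OF jet1_ident[of "\<bar>y\<bar>"] jet1_ident[of "\<bar>y\<bar>"]] jet1_const[of "- y\<^sup>2"]]
    unfolding r_def[abs_def] by (simp add: power2_eq_square)
  \<comment> \<open>At \<open>t = 0\<close> the factor \<open>r\<close> vanishes, so the denominator
    reduces to \<open>2 |y| S0\<close>.\<close>
  obtain q0 q1 where jq: "jet1 q q0 q1" and "q0 \<noteq> 0"
  proof -
    obtain b where b: "jet1 (\<lambda>t. X0_series 1 ((\<bar>y\<bar> + t)\<^sup>2)) (X0_series 1 (\<bar>y\<bar>\<^sup>2)) b"
      using ex_jet1_X0_series_square by blast
    note H = jet1_mult[OF jet1_ident[of "\<bar>y\<bar>"] jet1_mult[OF jet1_const[of 2]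
          jet1_add[OF S jet1_mult[OF jet1_const[of "-1"] jet1_mult[OF r b]]]]]
    have nz: "\<bar>y\<bar> * (2 * (S0 + - 1 * (0 * X0_series 1 (\<bar>y\<bar>\<^sup>2)))) \<noteq> 0"
      using \<open>S0 > 0\<close> \<open>y \<noteq> 0\<close> by simp
    show ?thesis
    proof (rule that)
      show "inverse (\<bar>y\<bar> * (2 * (S0 + - 1 * (0 * X0_series 1 (\<bar>y\<bar>\<^sup>2))))) \<noteq> 0"
        using nz by simp
    qed (use jet1_inverse[OF H nz] in \<open>simp only: q_def[abs_def]\<close>)
  qed
  have u: "jet1 (\<lambda>t. ((\<bar>y\<bar> + t)\<^sup>2 - y\<^sup>2) / ((\<bar>y\<bar> + t) * h (\<bar>y\<bar> + t) y)) 0 (2 * \<bar>y\<bar> * q0)"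
  proof -
    have "((\<bar>y\<bar> + t)\<^sup>2 - y\<^sup>2) / ((\<bar>y\<bar> + t) * h (\<bar>y\<bar> + t) y) = r t * q t" for t
      by (simp add: r_def power2_eq_square flip: q)
    then show ?thesis using jet1_mult[OF r jq] by simp
  qed
  have K: "jet1 (\<lambda>t. - c1 (\<bar>y\<bar> + t) y * s) (2 * s * (q0 * S0)) (2 * s * (q0 * S1 + q1 * S0))"
  proof -
    have "- c1 (\<bar>y\<bar> + t) y * s = 2 * s * (q t * S t)" for t
      by (simp add: c1_def S_def X0_eq_series flip: q)
    then show ?thesis using jet1_mult[OF jet1_const[of "2 * s"] jet1_mult[OF jq S]] by simp
  qed
  have L: "jet1 (\<lambda>t. - b1 (\<bar>y\<bar> + t) y) (q0 * S0) (q0 * (S1 + sqrt 5 * (2 * \<bar>y\<bar>)) + q1 * S0)"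
  proof -
    have "- b1 (\<bar>y\<bar> + t) y = q t * (S t + sqrt 5 * r t)" for t
      by (simp add: b1_def S_def r_def X0_eq_series power2_eq_square flip: q)
    then show ?thesis
      using jet1_mult[OF jq jet1_add[OF S jet1_mult[OF jet1_const[of "sqrt 5"] r]]] by simp
  qed
  \<comment> \<open>the normal \<open>n\<close> is constant because \<open>a1 = - y * c1\<close>\<close>
  define m where "m x = (y / s) *\<^sub>R \<phi> (x, y) + (1 / s) *\<^sub>R X\<beta> (x, y)" for x
  define n where "n x = 1 *\<^sub>R \<phi> (x, y) + (- y) *\<^sub>R X\<beta> (x, y)" for x
  have y0: "\<bar>y\<bar> > 0" using \<open>y \<noteq> 0\<close> by simp
  have ips: "orthonormal_list [\<phi> (x, y), X\<alpha> (x, y), X\<beta> (x, y), \<xi> (x, y)]" if "x > 0" for x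
    using F that by blast
  note ip = orthonormal_frame_inner[OF ips]
  show ?thesis
  proof (rule cusp_234_of_framed_curve[where v = "\<lambda>x. X\<alpha> (x, y)" and m = m and w = "\<lambda>x. \<xi> (x, y)"
        and n = n and u = "\<lambda>x. (x\<^sup>2 - y\<^sup>2) / (x * h x y)" and K = "\<lambda>x. - c1 x y * s" and L = "\<lambda>x. - b1 x y",
        OF _ _ _ _ _ _ _ _ _ _ _ _ _ _ u _ K L])
    show "((\<lambda>x. X\<alpha> (x, y)) has_vector_derivative (- c1 x y * s) *\<^sub>R m x + (- b1 x y) *\<^sub>R \<xi> (x, y)) (at x)"
      if "x \<in> {0<..}" for x
    proof -
      have *: "(- c1 x y * s) *\<^sub>R m x + (- b1 x y) *\<^sub>R \<xi> (x, y)
          = a1 x y *\<^sub>R \<phi> (x, y) - b1 x y *\<^sub>R \<xi> (x, y) - c1 x y *\<^sub>R X\<beta> (x, y)"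
        using \<open>s > 0\<close> by (simp add: m_def a1 scaleR_add_right mult.commute)
      show ?thesis unfolding * using F[of x y] that by simp
    qed
    show "(m has_vector_derivative - (- c1 x y * s) *\<^sub>R X\<alpha> (x, y)) (at x)" if "x \<in> {0<..}" for x
    proof -
      have "(m has_vector_derivative (y / s) *\<^sub>R - a1 x y *\<^sub>R X\<alpha> (x, y)
          + (1 / s) *\<^sub>R c1 x y *\<^sub>R X\<alpha> (x, y)) (at x)"
        unfolding m_def[abs_def] using F[of x y] that by (intro has_vector_derivative_lincomb) auto
      moreover have "y / s * - a1 x y + 1 / s * c1 x y = c1 x y * (s * s) / s"
        using \<open>s > 0\<close> unfolding s2 a1 by (simp add: field_simps power2_eq_square)
      ultimately show ?thesis
        using \<open>s > 0\<close> by (simp flip: scaleR_diff_left)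
    qed
    show "(n has_vector_derivative 0) (at x)" if "x \<in> {0<..}" for x
    proof -
      have "(n has_vector_derivative 1 *\<^sub>R - a1 x y *\<^sub>R X\<alpha> (x, y)
          + (- y) *\<^sub>R c1 x y *\<^sub>R X\<alpha> (x, y)) (at x)"
        unfolding n_def[abs_def] using F[of x y] that by (intro has_vector_derivative_lincomb) auto
      then show ?thesis by (simp add: a1)
    qed
    show "((\<lambda>x. \<xi> (x, y)) has_vector_derivative - (- b1 x y) *\<^sub>R X\<alpha> (x, y)) (at x)" if "x \<in> {0<..}" for x
      using F[of x y] that by simp
    have "(1 + y\<^sup>2) / (s * s) = 1" using \<open>s > 0\<close> s2 by (metis divide_self_if mult_pos_pos order_less_irrefl)
    then show "orthonormal_list [X\<alpha> (\<bar>y\<bar>, y), m \<bar>y\<bar>, \<xi> (\<bar>y\<bar>, y)]"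
      by (simp add: orthonormal_list_def All_less_Suc eval_nat_numeral m_def ip[OF y0]
          inner_add_left inner_add_right add_divide_distrib)
    have "n \<bar>y\<bar> \<bullet> \<phi> (\<bar>y\<bar>, y) = 1"
      by (simp add: n_def inner_diff_left ip[OF y0])
    then show "n \<bar>y\<bar> \<noteq> 0" by auto
    show "n x \<bullet> X\<alpha> (x, y) = 0" if "x \<in> {0<..}" for x
      using that by (simp add: n_def inner_diff_left ip)
    show "n \<bar>y\<bar> \<bullet> m \<bar>y\<bar> = 0" "n \<bar>y\<bar> \<bullet> \<xi> (\<bar>y\<bar>, y) = 0"
      by (simp_all add: n_def m_def inner_diff_left inner_add_right ip[OF y0])
    show "2 * \<bar>y\<bar> * q0 \<noteq> 0" using \<open>q0 \<noteq> 0\<close> y0 by simp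
    \<comment> \<open>The unspecified slopes \<open>S1\<close> and \<open>q1\<close> cancel; only
      the slope \<open>2 |y|\<close> of \<open>r\<close> survives.\<close>
    have "2 * s * (q0 * S0) * (q0 * (S1 + sqrt 5 * (2 * \<bar>y\<bar>)) + q1 * S0)
        - q0 * S0 * (2 * s * (q0 * S1 + q1 * S0)) = 4 * s * q0\<^sup>2 * S0 * sqrt 5 * \<bar>y\<bar>"
      by (simp add: algebra_simps power2_eq_square)
    then show "2 * s * (q0 * S0) * (q0 * (S1 + sqrt 5 * (2 * \<bar>y\<bar>)) + q1 * S0)
        - q0 * S0 * (2 * s * (q0 * S1 + q1 * S0)) \<noteq> 0"
      using \<open>q0 \<noteq> 0\<close> \<open>S0 > 0\<close> \<open>s > 0\<close> \<open>y \<noteq> 0\<close> by simp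
  qed (use f' y0 in \<open>auto simp: is_interval_1\<close>)
qed

section \<open>Cusps of the y-curves\<close>

text \<open>Here \<open>K = a2\<close> equals -1 at \<open>y = 0\<close> with slope 0, while
  \<open>L\<close> is \<open>- R\<close> times the speed factor \<open>g\<close>, which has slope
  \<open>2/A\<close> at its zero. The cusp condition is thus
  \<open>2 R / A \<noteq> 0\<close>.\<close>

lemma y_curve_cusp:
  fixes f \<phi> X\<alpha> X\<beta> \<xi> :: "real \<times> real \<Rightarrow> real^4"
  assumes frame: "frame_field \<phi> X\<alpha> X\<beta> \<xi>"
    and f': "\<And>y. ((\<lambda>s. f (x, s)) has_vector_derivative (2 * y / h x y) *\<^sub>R X\<beta> (x, y)) (at y)"
    and "x > 0"
  shows "\<exists>V. cusp_234_in V UNIV (\<lambda>y. f (x, y)) 0"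
proof -
  note F = frame[unfolded frame_field_def half_plane_def, THEN conjunct2, THEN conjunct2,
      THEN conjunct2, THEN conjunct2, simplified, rule_format, OF \<open>x > 0\<close>]
  define W where "W = X0' x / x"
  have W: "W = 2 * X0_series 1 (x\<^sup>2)"
    using \<open>x > 0\<close> by (simp add: W_def X0'_div_eq)
  \<comment> \<open>\<open>A\<close> is \<open>h x 0\<close>, and \<open>h x y = A + y^2 W\<close>
    isolates the dependence on \<open>y\<close>.\<close>
  define A where "A = 2 * X0 x + sqrt 5 - x\<^sup>2 * W"
  have "A = 2 * (X0_series 0 (x\<^sup>2) - x\<^sup>2 * X0_series 1 (x\<^sup>2)) + sqrt 5"
    by (simp add: A_def W X0_eq_series)
  then have "A > 0"
    using X0_series_0_gt[of "x\<^sup>2"] by (simp add: add_pos_pos)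
  have xW: "x * X0' x = x * (x * W)"
    using \<open>x > 0\<close> by (simp add: W_def)
  have h: "h x y = A + y * y * W" for y
    by (simp add: h_def A_def power2_eq_square xW flip: W_def)
  \<comment> \<open>Both \<open>b2\<close> and \<open>c2\<close> are \<open>g\<close> times a factor
    depending on \<open>x\<close> alone, \<open>- B\<close> and \<open>C\<close>; as
    \<open>B > 0\<close>, the vector \<open>(B, C)\<close> has positive length
    \<open>R\<close>.\<close>
  define B C where "B = X0' x / (2 * x) + sqrt 5" and "C = X0'' x - X0' x / x"
  have "B = X0_series 1 (x\<^sup>2) + sqrt 5"
    using \<open>x > 0\<close> by (simp add: B_def X0'_eq)
  then have "B > 0"
    using X0_series_1_pos[of "x\<^sup>2"] by (simp add: add_pos_nonneg)
  define R where "R = sqrt (B\<^sup>2 + C\<^sup>2)"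
  have "R > 0" and R2: "R * R = B * B + C * C"
    using \<open>B > 0\<close> by (simp_all add: R_def add_pos_nonneg power2_eq_square)
  define g where "g y = 2 * y / h x y" for y
  have b2: "b2 x y = - (g y * B)" and c2: "c2 x y = g y * C" for y
    by (simp_all add: b2_def c2_def g_def B_def C_def)
  define q where "q t = inverse (A + t * t * W)" for t
  have t: "jet1 (\<lambda>t. t) 0 1" using jet1_ident[of 0] by simp
  have tt: "jet1 (\<lambda>t. t * t * c) 0 0" for c
    using jet1_mult[OF jet1_mult[OF t t] jet1_const[of c]] by simp
  have jq: "jet1 q (inverse A) 0"
    using jet1_inverse[OF jet1_add[OF jet1_const[of A] tt[of W]]] \<open>A > 0\<close> unfolding q_def[abs_def] by simp
  have jg: "jet1 (\<lambda>t. g (0 + t)) 0 (2 / A)"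
    using jet1_mult[OF jet1_mult[OF jet1_const[of 2] t] jq]
    by (simp add: g_def[abs_def] h q_def[abs_def] divide_inverse)
  \<comment> \<open>In terms of \<open>A\<close> and \<open>W\<close>, \<open>a2\<close> is
    \<open>- (A - y^2 W) / (A + y^2 W)\<close>, which is even in \<open>y\<close>.\<close>
  have K: "jet1 (\<lambda>t. a2 x (0 + t)) (- 1) 0"
  proof -
    have "a2 x t = - 1 * (q t * (A + t * t * - W))" for t
      unfolding a2_def W_def[symmetric]
      by (simp add: q_def h A_def divide_inverse power2_eq_square algebra_simps)
    then show ?thesis
      using jet1_mult[OF jet1_const[of "-1"] jet1_mult[OF jq jet1_add[OF jet1_const[of A] tt[of "- W"]]]] \<open>A > 0\<close>
      by simp
  qed
  have L: "jet1 (\<lambda>t. - R * g (0 + t)) 0 (- R * (2 / A))"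
    using jet1_mult[OF jet1_const[of "- R"] jg] by simp
  \<comment> \<open>the normal \<open>n\<close> is constant because \<open>b2\<close> and \<open>c2\<close> have a ratio independent of \<open>y\<close>\<close>
  define w where "w y = (- B / R) *\<^sub>R \<xi> (x, y) + (C / R) *\<^sub>R X\<alpha> (x, y)" for y
  define n where "n y = C *\<^sub>R \<xi> (x, y) + B *\<^sub>R X\<alpha> (x, y)" for y
  have "orthonormal_list [\<phi> (x, y), X\<alpha> (x, y), X\<beta> (x, y), \<xi> (x, y)]" for y
    using F by blast
  note ip = orthonormal_frame_inner[OF this]
  show ?thesis
  proof (rule cusp_234_of_framed_curve[where v = "\<lambda>y. X\<beta> (x, y)" and m = "\<lambda>y. \<phi> (x, y)" and w = w
        and n = n and u = g and K = "a2 x" and L = "\<lambda>y. - R * g y",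
        OF _ _ _ _ _ _ _ _ _ _ _ _ _ _ jg _ K L])
    show "((\<lambda>y. X\<beta> (x, y)) has_vector_derivative a2 x y *\<^sub>R \<phi> (x, y) + (- R * g y) *\<^sub>R w y) (at y)" for y
    proof -
      have *: "a2 x y *\<^sub>R \<phi> (x, y) + (- R * g y) *\<^sub>R w y
          = a2 x y *\<^sub>R \<phi> (x, y) - b2 x y *\<^sub>R \<xi> (x, y) - c2 x y *\<^sub>R X\<alpha> (x, y)"
        using \<open>R > 0\<close> by (simp add: w_def b2 c2 scaleR_diff_right)
      show ?thesis unfolding * using F[of y] by simp
    qed
    show "(w has_vector_derivative - (- R * g y) *\<^sub>R X\<beta> (x, y)) (at y)" for y
    proof -
      have "(w has_vector_derivative (- B / R) *\<^sub>R b2 x y *\<^sub>R X\<beta> (x, y)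
          + (C / R) *\<^sub>R c2 x y *\<^sub>R X\<beta> (x, y)) (at y)"
        unfolding w_def[abs_def] using F[of y] by (intro has_vector_derivative_lincomb) auto
      moreover have "- B / R * b2 x y + C / R * c2 x y = g y * (R * R) / R"
        unfolding R2 by (simp add: b2 c2 algebra_simps add_divide_distrib)
      ultimately show ?thesis
        using \<open>R > 0\<close> by (simp add: mult.commute flip: scaleR_diff_left)
    qed
    show "(n has_vector_derivative 0) (at y)" for y
    proof -
      have "(n has_vector_derivative C *\<^sub>R b2 x y *\<^sub>R X\<beta> (x, y)
          + B *\<^sub>R c2 x y *\<^sub>R X\<beta> (x, y)) (at y)"
        unfolding n_def[abs_def] using F[of y] by (intro has_vector_derivative_lincomb) auto
      then show ?thesis by (simp add: b2 c2 mult_ac)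
    qed
    show "((\<lambda>y. \<phi> (x, y)) has_vector_derivative - a2 x y *\<^sub>R X\<beta> (x, y)) (at y)" for y
      using F[of y] by simp
    have "(B * B + C * C) / (R * R) = 1" using \<open>R > 0\<close> R2 by (metis divide_self_if mult_pos_pos order_less_irrefl)
    then show "orthonormal_list [X\<beta> (x, 0), \<phi> (x, 0), w 0]"
      by (simp add: orthonormal_list_def All_less_Suc eval_nat_numeral w_def ip
          inner_diff_left inner_diff_right inner_add_left inner_add_right add_divide_distrib)
    have "n 0 \<bullet> X\<alpha> (x, 0) = B"
      by (simp add: n_def inner_add_left ip)
    then show "n 0 \<noteq> 0" using \<open>B > 0\<close> by auto
    show "n y \<bullet> X\<beta> (x, y) = 0" for y
      by (simp add: n_def inner_add_left ip)
    show "n 0 \<bullet> \<phi> (x, 0) = 0" "n 0 \<bullet> w 0 = 0"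
      by (simp_all add: n_def w_def inner_diff_right inner_add_left inner_add_right ip)
  qed (use f' \<open>A > 0\<close> \<open>R > 0\<close> in \<open>auto simp: g_def[abs_def] is_interval_univ\<close>)
qed

theorem theorem3p8:
  fixes f :: "real \<times> real \<Rightarrow> real^4"
  assumes "curvature_surface f"
  shows "(\<forall>y. y \<noteq> 0 \<longrightarrow> (\<exists>V. cusp_234_in V {0<..} (\<lambda>x. f (x, y)) \<bar>y\<bar>)) \<and>
         (\<forall>x. x > 0 \<longrightarrow> (\<exists>V. cusp_234_in V UNIV (\<lambda>y. f (x, y)) 0))"
proof -
  obtain \<phi> X\<alpha> X\<beta> \<xi> where frame: "frame_field \<phi> X\<alpha> X\<beta> \<xi>"
    and f': "\<And>x y. x > 0 \<Longrightarrow> (f has_derivative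
              (\<lambda>(dx, dy). (dx * ((x\<^sup>2 - y\<^sup>2) / (x * h x y))) *\<^sub>R X\<alpha> (x, y)
                        + (dy * (2 * y / h x y)) *\<^sub>R X\<beta> (x, y))) (at (x, y))"
    using assms unfolding curvature_surface_def half_plane_def by fast
  have "((\<lambda>s. f (s, y)) has_vector_derivative ((x\<^sup>2 - y\<^sup>2) / (x * h x y)) *\<^sub>R X\<alpha> (x, y)) (at x)"
    if "x > 0" for x y
  proof -
    \<comment> \<open>Restricting the total derivative of \<open>f\<close> to a coordinate line
      leaves only one of its two terms.\<close>
    have "((\<lambda>s. (s, y)) has_derivative (\<lambda>s. (s, 0))) (at x)"
      by (auto intro!: derivative_eq_intros)
    from has_derivative_compose[OF this f'[OF that]] show ?thesis
      by (simp add: has_vector_derivative_def)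
  qed
  moreover have "((\<lambda>s. f (x, s)) has_vector_derivative (2 * y / h x y) *\<^sub>R X\<beta> (x, y)) (at y)"
    if "x > 0" for x y
  proof -
    have "((\<lambda>s. (x, s)) has_derivative (\<lambda>s. (0, s))) (at y)"
      by (auto intro!: derivative_eq_intros)
    from has_derivative_compose[OF this f'[OF that]] show ?thesis
      by (simp add: has_vector_derivative_def)
  qed
  ultimately show ?thesis
    using x_curve_cusp[OF frame] y_curve_cusp[OF frame] by blast
qed

end
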